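(* Let $\varGamma=\{0,1,\dots,n\}\times\{0,1,\dots,n\}$, totally ordered lexicographically, and let $F:C(R_n)\to\varGamma$ be the edge-labeling of the rook monoid $R_n$ (with the Bruhat–Chevalley–Renner order) defined by $F((x,y))=(a_i,b_i)$ if $y$ covers $x$ by type 1 (at position $i$) and $F((x,y))=(a_i,a_j)$ if $y$ covers $x$ by type 2 (at positions $i<j$). Then $F$ is an $EL$-labeling of $R_n$. In particular, $R_n$ is lexicographically ($EL$-)shellable.
   Context: $R_n$ (the rook monoid) is the set of $n\times n$ $0/1$ matrices with at most one $1$ in each row and each column. An element $x=(x_{ij})$ is encoded as a sequence $(a_1,\dots,a_n)$ with $a_j=0$ if column $j$ of $x$ is zero and $a_j=i$ if $x_{ij}=1$. The Bruhat–Chevalley–Renner order on $R_n$ is defined by $r\le t$ iff $BrB\subseteq \overline{BtB}$ (Zariski closure in the $n\times n$ matrices over an algebraically closed field, $B$ the invertible upper triangular matrices); equivalently, it is the smallest partial order on $R_n$ such that $x=(a_1,\dots,a_n)\le y=(b_1,\dots,b_n)$ whenever either (1) there is $i$ with $b_i>a_i$ and $b_k=a_k$ for $k\ne i$, or (2) there are $i<j$ with $b_i=a_j$, $b_j=a_i$, $b_i>b_j$, and $b_k=a_k$ for $k\notin\{i,j\}$. This poset is graded with rank function $\ell(x)=\sum_i a_i+\mathrm{inv}(x)$, where $\mathrm{inv}(x)=|\{(i,j): i<j,\ a_i>a_j\}|$. $C(R_n)$ is the set of pairs $(x,y)$ with $y$ covering $x$. A covering $(x,y)$ is of type 1 if $x,y$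 differ only in one position $i$ with $a_i<b_i$; it is of type 2 if there are $i<j$ with $a_i<a_j$, $b_i=a_j$, $b_j=a_i$ and $b_k=a_k$ for $k\notin\{i,j\}$; every covering is of exactly one of these types. For a graded poset $P$ and a totally ordered set $\varGamma$, an edge-labeling $f:C(P)\to\varGamma$ assigns to a maximal chain $\mathfrak c: x=x_0<x_1<\dots<x_k=y$ of an interval its Jordan–Hölder sequence $f(\mathfrak c)=(f((x_0,x_1)),\dots,f((x_{k-1},x_k)))\in\varGamma^k$, ordered lexicographically; $\mathfrak c$ is increasing if $f((x_0,x_1))\le\dots\le f((x_{k-1},x_k))$. $f$ is an $EL$-labeling if for every interval $[x,y]$ of rank $k>0$ there is a unique increasing maximal chain, and its Jordan–Hölder sequence is the lexicographically smallest among those of all maximal chains of $[x,y]$. *)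

theory Defs
  imports
    "Jordan_Normal_Form.Matrix"
    "HOL-Library.FuncSet"
    "HOL-Library.Product_Lexorder"
begin

section \<open>Graded posets and EL-labelings\<close>

text \<open>A poset is a carrier set \<open>P\<close> with a relation \<open>r\<close> on it (\<open>partial_order_on P r\<close>).\<close>

definition covers :: "'a set \<Rightarrow> 'a rel \<Rightarrow> 'a rel" where
  "covers P r = {(x, y). x \<in> P \<and> y \<in> P \<and> (x, y) \<in> r \<and> x \<noteq> y \<and>
     \<not> (\<exists>z\<in>P. (x, z) \<in> r \<and> (z, y) \<in> r \<and> z \<noteq> x \<and> z \<noteq> y)}"

definition rank_function :: "'a set \<Rightarrow> 'a rel \<Rightarrow> ('a \<Rightarrow> nat) \<Rightarrow> bool" where
  "rank_function P r \<rho> \<longleftrightarrow>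
     (\<forall>x\<in>P. \<forall>y\<in>P. (x, y) \<in> r \<and> x \<noteq> y \<longrightarrow> \<rho> x < \<rho> y) \<and>
     (\<forall>(x, y) \<in> covers P r. \<rho> y = Suc (\<rho> x))"

definition graded_poset :: "'a set \<Rightarrow> 'a rel \<Rightarrow> bool" where
  "graded_poset P r \<longleftrightarrow> partial_order_on P r \<and> (\<exists>\<rho>. rank_function P r \<rho>)"

text \<open>The maximal chains \<open>x = x\<^sub>0 < \<dots> < x\<^sub>k = y\<close> of the interval \<open>[x, y]\<close>, as lists
  \<open>[x\<^sub>0, \<dots>, x\<^sub>k]\<close>; in a graded poset these are exactly the chains from \<open>x\<close> to \<open>y\<close>
  all of whose steps are coverings.\<close>

definition maximal_chains :: "'a set \<Rightarrow> 'a rel \<Rightarrow> 'a \<Rightarrow> 'a \<Rightarrow> 'a list set" where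
  "maximal_chains P r x y =
     {c. c \<noteq> [] \<and> hd c = x \<and> last c = y \<and> successively (\<lambda>u v. (u, v) \<in> covers P r) c}"

definition jordan_holder :: "('a \<times> 'a \<Rightarrow> 'c) \<Rightarrow> 'a list \<Rightarrow> 'c list" where
  "jordan_holder f c = map f (zip c (tl c))"

definition lex_le :: "'c::linorder list \<Rightarrow> 'c list \<Rightarrow> bool" where
  "lex_le s t \<longleftrightarrow> s = t \<or> (s, t) \<in> lex {(a, b). a < b}"

text \<open>The totally ordered set of labels is a subset \<open>\<Gamma>\<close> of a linearly ordered type. In a graded
  poset, the intervals \<open>[x, y]\<close> of positive rank are those with \<open>x < y\<close>.\<close>

definition EL_labeling ::
  "'a set \<Rightarrow> 'a rel \<Rightarrow> 'c::linorder set \<Rightarrow> ('a \<times> 'a \<Rightarrow> 'c) \<Rightarrow> bool" where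
  "EL_labeling P r \<Gamma> f \<longleftrightarrow>
     graded_poset P r \<and> f \<in> covers P r \<rightarrow> \<Gamma> \<and>
     (\<forall>x\<in>P. \<forall>y\<in>P. (x, y) \<in> r \<and> x \<noteq> y \<longrightarrow>
        (\<exists>!c. c \<in> maximal_chains P r x y \<and> sorted (jordan_holder f c)) \<and>
        (\<forall>c \<in> maximal_chains P r x y. sorted (jordan_holder f c) \<longrightarrow>
           (\<forall>d \<in> maximal_chains P r x y. lex_le (jordan_holder f c) (jordan_holder f d))))"

text \<open>The type argument is the linearly ordered type in which the labels live: HOL cannot
  quantify existentially over it.\<close>

definition EL_shellable :: "'c::linorder itself \<Rightarrow> 'a set \<Rightarrow> 'a rel \<Rightarrow> bool" where
  "EL_shellable _ P r \<longleftrightarrow> (\<exists>(\<Gamma> :: 'c set) f. EL_labeling P r \<Gamma> f)"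


section \<open>The rook monoid\<close>

definition rook_monoid :: "nat \<Rightarrow> nat mat set" where
  "rook_monoid n = {x \<in> carrier_mat n n.
     (\<forall>i<n. \<forall>j<n. x $$ (i, j) \<in> {0, 1}) \<and>
     (\<forall>i<n. card {j. j < n \<and> x $$ (i, j) = 1} \<le> 1) \<and>
     (\<forall>j<n. card {i. i < n \<and> x $$ (i, j) = 1} \<le> 1)}"

text \<open>The sequence \<open>(a\<^sub>1, \<dots>, a\<^sub>n)\<close> encoding a rook matrix. Matrix indices and list positions start
  at \<open>0\<close>, whereas the entries \<open>a\<^sub>j\<close> number the rows from \<open>1\<close>, with \<open>0\<close> marking a zero column.\<close>

definition rook_word :: "nat mat \<Rightarrow> nat list" where
  "rook_word x = map (\<lambda>j. if \<exists>i < dim_row x. x $$ (i, j) = 1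
     then Suc (THE i. i < dim_row x \<and> x $$ (i, j) = 1) else 0) [0..<dim_col x]"

definition type1 :: "nat list \<Rightarrow> nat list \<Rightarrow> nat \<Rightarrow> bool" where
  "type1 a b i \<longleftrightarrow> length b = length a \<and> i < length a \<and> a ! i < b ! i \<and>
     (\<forall>k < length a. k \<noteq> i \<longrightarrow> b ! k = a ! k)"

definition type2 :: "nat list \<Rightarrow> nat list \<Rightarrow> nat \<Rightarrow> nat \<Rightarrow> bool" where
  "type2 a b i j \<longleftrightarrow> length b = length a \<and> i < j \<and> j < length a \<and> a ! i < a ! j \<and>
     b ! i = a ! j \<and> b ! j = a ! i \<and>
     (\<forall>k < length a. k \<noteq> i \<and> k \<noteq> j \<longrightarrow> b ! k = a ! k)"

definition bruhat_steps :: "nat \<Rightarrow> nat mat rel" where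
  "bruhat_steps n = {(x, y). x \<in> rook_monoid n \<and> y \<in> rook_monoid n \<and>
     ((\<exists>i. type1 (rook_word x) (rook_word y) i) \<or>
      (\<exists>i j. type2 (rook_word x) (rook_word y) i j))}"

text \<open>The Bruhat--Chevalley--Renner order: the smallest partial order containing the above steps.\<close>

definition bruhat_le :: "nat \<Rightarrow> nat mat rel" where
  "bruhat_le n = \<Inter> {r. partial_order_on (rook_monoid n) r \<and> bruhat_steps n \<subseteq> r}"

text \<open>The two cases exclude each other, and the positions are determined by \<open>x\<close> and \<open>y\<close>, since
  \<open>type1\<close> pairs differ in one position and \<open>type2\<close> pairs in two. So the label is well defined
  whenever \<open>(x, y)\<close> is of one of the two types, in particular for every covering.\<close>

definition rook_label :: "nat mat \<times> nat mat \<Rightarrow> nat \<times> nat" where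
  "rook_label = (\<lambda>(x, y). let a = rook_word x; b = rook_word y in
     THE l. (\<exists>i. type1 a b i \<and> l = (a ! i, b ! i)) \<or>
            (\<exists>i j. type2 a b i j \<and> l = (a ! i, a ! j)))"

end

(* Continue a rook word to the right by the values it does not use, in decreasing order (there are
   n zeros and one copy of each of 1, ..., n). Then both types of coverings are swaps of a value v
   at position p with a larger value w at a later position j such that no value between v and w
   occurs in between, the label is (v, w), and the order compares, for all i and u, the number of
   entries >= u among the first i.

   For g < h let v be minimal such that these counts differ at level v + 1, let w be the least value
   above v of g at a position j where the count at level v + 1 is too small, and p the last position
   of v before j. Swapping p and j stays below h, and (v, w) is strictly smaller than the label of
   every other covering of g inside [g, h]; the later labels of the interval are not smaller. So
   the greedy chain is increasing and lexicographically least. A different increasing chain would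
   only have labels > (v, w): then w stays at j while v is moved, and v can never jump over it, so
   the count at j and level v + 1 would never increase. *)

theory Submission
  imports Defs
begin

section \<open>Swaps and counts\<close>

definition rk :: "(nat \<Rightarrow> nat) \<Rightarrow> nat \<Rightarrow> nat \<Rightarrow> nat" where
  "rk g i u = card {k. k < i \<and> u \<le> g k}"

definition rk_le :: "nat \<Rightarrow> (nat \<Rightarrow> nat) \<Rightarrow> (nat \<Rightarrow> nat) \<Rightarrow> bool" where
  "rk_le N g h \<longleftrightarrow> (\<forall>i\<le>N. \<forall>u. rk g i u \<le> rk h i u)"

lemma rk_0 [simp]: "rk g 0 u = 0"
  by (simp add: rk_def)

lemma rk_level_0 [simp]: "rk g i 0 = i"
  by (simp add: rk_def)

lemma rk_Suc [simp]: "rk g (Suc i) u = rk g i u + (if u \<le> g i then 1 else 0)"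
proof -
  have "{k. k < Suc i \<and> u \<le> g k} =
      (if u \<le> g i then insert i {k. k < i \<and> u \<le> g k} else {k. k < i \<and> u \<le> g k})"
    by (auto simp: less_Suc_eq)
  then show ?thesis
    by (simp add: rk_def)
qed

lemma rk_cong: "(\<And>k. k < i \<Longrightarrow> g k = h k) \<Longrightarrow> rk g i u = rk h i u"
  by (induction i) auto

text \<open>Moving the terms at \<open>i\<close> across turns both sides into counts over the
  positions in \<open>[i, r)\<close>, where fewer entries reach the higher level. The additive form
  avoids truncated subtraction.\<close>

lemma rk_bound_mono: "i \<le> r \<Longrightarrow> u \<le> v \<Longrightarrow> rk h r v + rk h i u \<le> rk h r u + rk h i v"
  by (induction r rule: dec_induct) auto

text \<open>No value in the window \<open>[i, r)\<close> lies in \<open>[u, v)\<close>, so both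
  levels gain equally there. Some later uses take level 0, where the count is the position, or a
  level above all values, where it is 0.\<close>

lemma rk_bound_eq:
  "i \<le> r \<Longrightarrow> u \<le> v \<Longrightarrow> (\<And>k. i \<le> k \<Longrightarrow> k < r \<Longrightarrow> u \<le> g k \<Longrightarrow> v \<le> g k) \<Longrightarrow>
    rk g r v + rk g i u = rk g r u + rk g i v"
proof (induction r rule: dec_induct)
  case (step m)
  have "u \<le> g m \<longleftrightarrow> v \<le> g m"
    using step.prems(1) step.prems(2)[of m] step.hyps by auto
  then show ?case
    using step by simp
qed simp

lemma rk_index_mono: "i \<le> r \<Longrightarrow> rk h i u \<le> rk h r u"
  by (induction r rule: dec_induct) auto

lemma rk_index_bound: "i \<le> r \<Longrightarrow> rk h r u \<le> rk h i u + (r - i)"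
  by (induction r rule: dec_induct) auto

lemma rk_level_agree:
  assumes "\<forall>i\<le>N. rk g i u = rk h i u" "k < N"
  shows "u \<le> g k \<longleftrightarrow> u \<le> h k"
  using assms(1)[rule_format, of k] assms(1)[rule_format, of "Suc k"] assms(2)
  by (simp split: if_splits)

lemma rk_eq_imp_eq:
  assumes "\<forall>i\<le>N. \<forall>u. rk g i u = rk h i u" "k < N"
  shows "g k = h k"
proof -
  have "u \<le> g k \<longleftrightarrow> u \<le> h k" for u
    using assms(1) by (intro rk_level_agree[OF _ assms(2)]) simp
  from this[of "g k"] this[of "h k"] show ?thesis
    by simp
qed

section \<open>Swaps and the counts they change\<close>

definition swap :: "(nat \<Rightarrow> nat) \<Rightarrow> nat \<Rightarrow> nat \<Rightarrow> nat \<Rightarrow> nat" where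
  "swap g p j = g(p := g j, j := g p)"

lemma swap_simps [simp]:
  "swap g p j p = g j" "swap g p j j = g p"
  "k \<noteq> p \<Longrightarrow> k \<noteq> j \<Longrightarrow> swap g p j k = g k"
  by (auto simp: swap_def)

text \<open>Only a prefix that contains \<open>p\<close> but not \<open>j\<close> sees the exchange,
  and only at levels that separate the two values.\<close>

lemma rk_swap:
  assumes "p < j" "g p < g j"
  shows "rk (swap g p j) i u =
    rk g i u + (if p < i \<and> i \<le> j \<and> g p < u \<and> u \<le> g j then 1 else 0)"
proof (induction i)
  case (Suc i)
  consider "i = p" | "i = j" | "i \<noteq> p" "i \<noteq> j"
    by blast
  then show ?case
    by cases (use Suc assms in auto)
qed simp

text \<open>Both inequalities are strict, so further copies of \<open>g p\<close> between the
  positions are excluded as well. This matters for the value 0, which may repeat, and makes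
  \<open>p\<close> determined by its value and \<open>j\<close>.\<close>

definition cover_swap :: "nat \<Rightarrow> (nat \<Rightarrow> nat) \<Rightarrow> nat \<Rightarrow> nat \<Rightarrow> bool" where
  "cover_swap N g p j \<longleftrightarrow> p < j \<and> j < N \<and> g p < g j \<and>
     (\<forall>k. p < k \<and> k < j \<longrightarrow> g k < g p \<or> g j < g k)"

lemma rk_swap_rectangle:
  assumes "cover_swap N g p j" "rk_le N (swap g p j) h"
    and "p < i" "i \<le> j" "g p < u" "u \<le> g j"
  shows "rk g i u < rk h i u"
proof -
  have "rk (swap g p j) i u \<le> rk h i u"
    using assms unfolding rk_le_def cover_swap_def by auto
  then show ?thesis
    using assms rk_swap[of p j g i u] by (simp add: cover_swap_def)
qed

section \<open>The inversion number as rank\<close>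

definition inversions :: "nat \<Rightarrow> (nat \<Rightarrow> nat) \<Rightarrow> nat" where
  "inversions N g = (\<Sum>k<N. rk g k (Suc (g k)))"

text \<open>Position \<open>k\<close> contributes the larger entries before it, so the sum counts
  inverted pairs. As no value between the positions separates \<open>g p\<close> from
  \<open>g j\<close>, only the terms at \<open>p\<close> and \<open>j\<close> change, and their sum
  grows by the new inverted pair.\<close>

lemma inversions_swap:
  assumes "cover_swap N g p j"
  shows "inversions N (swap g p j) = Suc (inversions N g)"
proof -
  let ?g = "swap g p j" let ?N = "{..<N} - {p} - {j}"
  have pj: "p < j" "j < N" "g p < g j"
    and between: "\<And>k. p < k \<Longrightarrow> k < j \<Longrightarrow> g k < g p \<or> g j < g k"
    using assms by (auto simp: cover_swap_def)
  have split: "inversions N f = rk f p (Suc (f p)) + (rk f j (Suc (f j)) +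
      (\<Sum>k\<in>?N. rk f k (Suc (f k))))" for f
    unfolding inversions_def using pj
    by (subst sum.remove[of _ p], simp, simp, subst sum.remove[of _ j]) auto
  have "(\<Sum>k\<in>?N. rk ?g k (Suc (?g k))) = (\<Sum>k\<in>?N. rk g k (Suc (g k)))"
  proof (intro sum.cong refl)
    fix k assume k: "k \<in> ?N"
    then show "rk ?g k (Suc (?g k)) = rk g k (Suc (g k))"
      using pj between[of k] by (cases "p < k \<and> k < j") (auto simp: rk_swap)
  qed
  moreover have "rk ?g p (Suc (g j)) = rk g p (Suc (g j))"
    "rk ?g j (Suc (g p)) = Suc (rk g j (Suc (g p)))"
    using pj by (simp_all add: rk_swap)
  \<comment> \<open>After \<open>p\<close> and before \<open>j\<close>, the entries exceeding
    \<open>g p\<close> are exactly those exceeding \<open>g j\<close>.\<close>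
  moreover have "rk g j (Suc (g j)) + rk g p (Suc (g p)) = rk g j (Suc (g p)) + rk g p (Suc (g j))"
  proof (rule rk_bound_eq)
    fix k assume "p \<le> k" "k < j" "Suc (g p) \<le> g k"
    then show "Suc (g j) \<le> g k"
      using between[of k] by (cases "k = p") auto
  qed (use pj in auto)
  ultimately show ?thesis
    by (simp add: split)
qed

text \<open>The greedy swap. Minimality of \<open>v = g p\<close> is expressed by agreement at all
  levels up to \<open>g p\<close> and a deficit of \<open>g\<close> against \<open>h\<close> at
  level \<open>Suc (g p)\<close>; \<open>g j\<close> is the least larger value at a position with
  such a deficit.\<close>

definition min_swap :: "nat \<Rightarrow> (nat \<Rightarrow> nat) \<Rightarrow> (nat \<Rightarrow> nat) \<Rightarrow> nat \<Rightarrow> nat \<Rightarrow> bool" where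
  "min_swap N g h p j \<longleftrightarrow> cover_swap N g p j \<and>
     (\<forall>i\<le>N. \<forall>u\<le>g p. rk g i u = rk h i u) \<and>
     rk g j (Suc (g p)) < rk h j (Suc (g p)) \<and>
     (\<forall>k<N. g p < g k \<and> rk g k (Suc (g p)) < rk h k (Suc (g p)) \<longrightarrow> g j \<le> g k)"

text \<open>Agreement at level \<open>v\<close> means that the same positions carry values at least
  \<open>v\<close>. Where \<open>g\<close> avoids \<open>v\<close>, an entry of \<open>h\<close>
  above \<open>v\<close> is thus matched by one of \<open>g\<close>, so the lead of \<open>h\<close>
  at level \<open>Suc v\<close> cannot grow from \<open>i\<close> to \<open>j\<close>.\<close>

lemma deficit_antimono:
  assumes "\<forall>i\<le>N. rk g i v = rk h i v"
    and "i \<le> j" "j \<le> N"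
    and "\<And>k. i \<le> k \<Longrightarrow> k < j \<Longrightarrow> g k \<noteq> v"
  shows "rk h j (Suc v) + rk g i (Suc v) \<le> rk g j (Suc v) + rk h i (Suc v)"
  using assms(2-)
proof (induction j rule: dec_induct)
  case (step m)
  have "v \<le> g m \<longleftrightarrow> v \<le> h m"
    using rk_level_agree[OF assms(1)] step.prems(1) by simp
  then have "Suc v \<le> h m \<Longrightarrow> Suc v \<le> g m"
    using step.prems(2)[of m] step.hyps by auto
  then show ?case
    using step by auto
qed simp

lemma ex_min_swap:
  assumes le: "rk_le N g h" and total: "\<And>u. rk g N u = rk h N u"
    and "\<not> (\<forall>i\<le>N. \<forall>u. rk g i u = rk h i u)"
  shows "\<exists>p j. min_swap N g h p j"
proof -
  let ?eq = "\<lambda>u. \<forall>i\<le>N. rk g i u = rk h i u"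
  have le': "rk g i u \<le> rk h i u" if "i \<le> N" for i u
    using le that by (simp add: rk_le_def)
  have "\<exists>u. \<not> ?eq u"
    using assms(3) by blast
  then obtain u0 where u0: "\<not> ?eq u0" and below: "\<And>u. u < u0 \<Longrightarrow> ?eq u"
    by (subst (asm) exists_least_iff) blast
  \<comment> \<open>Level 0 counts every position, so it never differs and \<open>u0\<close> has a
    predecessor.\<close>
  then obtain v where v: "u0 = Suc v"
    using u0 by (cases u0) auto
  have eq_v: "?eq v" and eq_le_v: "\<And>u. u \<le> v \<Longrightarrow> ?eq u"
    using below v by auto
  define D where "D = {k. k < N \<and> v < g k \<and> rk g k (Suc v) < rk h k (Suc v)}"
  have "D \<noteq> {}"
  proof
    assume empty: "D = {}"
    have "\<exists>i<N. rk g i (Suc v) < rk h i (Suc v)"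
      using u0 v le' total by (metis le_neq_implies_less)
    then obtain i where i: "i < N" "rk g i (Suc v) < rk h i (Suc v)"
      by blast
    \<comment> \<open>Without a larger entry at a deficit position the count of \<open>g\<close>
      stands still, so the deficit at \<open>i\<close> would persist up to \<open>N\<close>, against
      the equal totals.\<close>
    have "rk g r (Suc v) < rk h r (Suc v)" if "i \<le> r" "r \<le> N" for r
      using that
    proof (induction r rule: dec_induct)
      case (step m)
      then have "\<not> v < g m"
        using empty by (auto simp: D_def)
      then show ?case
        using step by auto
    qed (use i in simp)
    then show False
      using i total by (metis less_irrefl order_refl less_imp_le)
  qed
  then have "\<exists>w. w \<in> g ` D"
    by blast
  then obtain w where w: "w \<in> g ` D" and "\<And>m. m < w \<Longrightarrow> m \<notin> g ` D"
    by (subst (asm) exists_least_iff) blast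
  then have w_min: "w \<le> g k" if "k \<in> D" for k
    using that by (metis imageI not_less)
  \<comment> \<open>The leftmost position with value \<open>w\<close> is taken, so that no further
    copy of \<open>w\<close> lies between \<open>p\<close> and \<open>j\<close>.\<close>
  have "\<exists>j. j \<in> D \<and> g j = w"
    using w by blast
  then obtain j where j: "j \<in> D" "g j = w" and "\<And>k. k < j \<Longrightarrow> \<not> (k \<in> D \<and> g k = w)"
    by (subst (asm) exists_least_iff) blast
  then have j_min: "j \<le> k" if "k \<in> D" "g k = w" for k
    using that by (metis not_less)
  have jD: "j < N" "v < w" "rk g j (Suc v) < rk h j (Suc v)"
    using j by (auto simp: D_def)
  \<comment> \<open>Otherwise the deficit at \<open>j\<close> would be at most the deficit at 0,
    which is 0.\<close>
  have "\<exists>p<j. g p = v"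
    using deficit_antimono[OF eq_v, of 0 j] jD by fastforce
  then have p: "Max {p. p < j \<and> g p = v} < j" "g (Max {p. p < j \<and> g p = v}) = v"
    using Max_in[of "{p. p < j \<and> g p = v}"] by auto
  define p where "p = Max {p. p < j \<and> g p = v}"
  have p: "p < j" "g p = v"
    using p by (simp_all add: p_def)
  have p_last: "g k \<noteq> v" if "p < k" "k < j" for k
  proof
    assume "g k = v"
    then have "k \<le> p"
      unfolding p_def using that by (intro Max_ge) auto
    then show False
      using that by simp
  qed
  have "g k < v \<or> w < g k" if k: "p < k" "k < j" for k
  proof (rule ccontr)
    assume "\<not> ?thesis"
    then have gk: "v < g k" "g k \<le> w"
      using p_last[OF k] by auto
    \<comment> \<open>As \<open>p\<close> is the last \<open>v\<close> before \<open>j\<close>, the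
      deficit at \<open>k\<close> is at least the one at \<open>j\<close>, so \<open>k\<close> would
      have been chosen instead of \<open>j\<close>.\<close>
    have "rk h j (Suc v) + rk g k (Suc v) \<le> rk g j (Suc v) + rk h k (Suc v)"
      by (rule deficit_antimono[OF eq_v]) (use p_last k jD in auto)
    then have "k \<in> D"
      using jD k gk by (auto simp: D_def)
    then show False
      using w_min[of k] j_min[of k] gk k by auto
  qed
  then have "cover_swap N g p j"
    using p j jD by (auto simp: cover_swap_def)
  then have "min_swap N g h p j"
    using p j jD eq_le_v w_min by (auto simp: min_swap_def D_def)
  then show ?thesis
    by blast
qed

text \<open>After \<open>p\<close> and before \<open>j\<close> the value \<open>g p\<close> does not
  occur, so the deficit at \<open>j\<close> forces one at every such \<open>i\<close>.\<close>

lemma min_swap_deficit: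
  assumes "min_swap N g h p j" "p < i" "i \<le> j"
  shows "rk g i (Suc (g p)) < rk h i (Suc (g p))"
proof -
  have *: "\<forall>i\<le>N. rk g i (g p) = rk h i (g p)" "j \<le> N"
    using assms by (auto simp: min_swap_def cover_swap_def)
  have "g k \<noteq> g p" if "i \<le> k" "k < j" for k
    using assms(1,2) that unfolding min_swap_def cover_swap_def
    by (metis less_le_trans less_irrefl less_asym)
  moreover have "rk g j (Suc (g p)) < rk h j (Suc (g p))"
    using assms by (simp add: min_swap_def)
  ultimately show ?thesis
    using deficit_antimono[OF *(1) assms(3) *(2)] by force
qed

text \<open>If the deficit at level \<open>u\<close> vanished at \<open>i\<close>, follow \<open>g\<close> to the right until the deficit at
  level \<open>g p + 1\<close> vanishes too: up to there \<open>g\<close> has no value in \<open>[g p + 1, u)\<close> by minimality of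
  \<open>g j\<close>, so at level \<open>u\<close> it would overtake \<open>h\<close>.\<close>

lemma min_swap_le:
  assumes min: "min_swap N g h p j" and le: "rk_le N g h" and total: "\<And>u. rk g N u = rk h N u"
  shows "rk_le N (swap g p j) h"
proof -
  let ?v = "Suc (g p)"
  have pj: "p < j" "j < N" "g p < g j"
    using min by (auto simp: min_swap_def cover_swap_def)
  have le': "rk g i u \<le> rk h i u" if "i \<le> N" for i u
    using le that by (simp add: rk_le_def)
  have "rk g i u < rk h i u" if i: "p < i" "i \<le> j" and u: "?v \<le> u" "u \<le> g j" for i u
  proof (rule ccontr)
    assume "\<not> ?thesis"
    then have eq: "rk g i u = rk h i u"
      using le'[of i u] i pj by simp
    have lt: "rk g i ?v < rk h i ?v"
      using min_swap_deficit[OF min i] .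
    define r where "r = (LEAST r. i \<le> r \<and> rk g r ?v = rk h r ?v)"
    have N: "i \<le> N \<and> rk g N ?v = rk h N ?v"
      using i pj total by auto
    have r: "i \<le> r" "rk g r ?v = rk h r ?v"
      using LeastI[of "\<lambda>r. i \<le> r \<and> rk g r ?v = rk h r ?v", OF N] by (auto simp: r_def)
    have rN: "r \<le> N"
      unfolding r_def by (rule Least_le) (use N in blast)
    have D: "rk g k ?v < rk h k ?v" if "i \<le> k" "k < r" for k
      using le'[of k ?v] rN that not_less_Least[of k "\<lambda>r. i \<le> r \<and> rk g r ?v = rk h r ?v"]
      by (force simp: r_def)
    have "rk g r u + rk g i ?v = rk g r ?v + rk g i u"
    proof (rule rk_bound_eq[OF r(1) u(1)])
      fix k assume k: "i \<le> k" "k < r" "?v \<le> g k"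
      then have "g j \<le> g k"
        using min D[of k] rN by (auto simp: min_swap_def)
      then show "u \<le> g k"
        using u by simp
    qed
    moreover have "rk h r u + rk h i ?v \<le> rk h r ?v + rk h i u"
      by (rule rk_bound_mono[OF r(1) u(1)])
    ultimately show False
      using lt eq r(2) le'[OF rN, of u] by simp
  qed
  then show ?thesis
    using pj le' unfolding rk_le_def by (auto simp: rk_swap Suc_le_eq)
qed

text \<open>With \<open>j\<close> in the tail, the danger is a later entry exceeding
  \<open>g p\<close>. By distinctness the entry right after \<open>j\<close> would then be smaller
  than \<open>g j\<close>, so minimality closes the deficit there. Hence \<open>h\<close> has
  already dropped to at most \<open>g p\<close> and stays there because it decreases, and
  \<open>g\<close> overtakes it one position later.\<close>

lemma antimono_tail_swap:
  assumes min: "min_swap N g h p j" and le: "rk_le N g h"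
    and g: "antimono_on {n..<N} g" and h: "antimono_on {n..<N} h"
    and distinct: "\<And>k l. k < N \<Longrightarrow> l < N \<Longrightarrow> g k = g l \<Longrightarrow> 0 < g k \<Longrightarrow> k = l"
  shows "antimono_on {n..<N} (swap g p j)"
proof -
  let ?v = "Suc (g p)"
  have pj: "p < j" "j < N" "g p < g j"
    using min by (auto simp: min_swap_def cover_swap_def)
  have g': "g l \<le> g k" if "n \<le> k" "k \<le> l" "l < N" for k l
    using g that by (auto simp: monotone_on_def)
  have h': "h l \<le> h k" if "n \<le> k" "k \<le> l" "l < N" for k l
    using h that by (auto simp: monotone_on_def)
  have le': "rk g i u \<le> rk h i u" if "i \<le> N" for i u
    using le that by (simp add: rk_le_def)
  have p: "p < n"
    using g'[of p j] pj by (cases "p < n") auto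
  have minD: "g j \<le> g k" if "k < N" "g p < g k" "rk g k ?v < rk h k ?v" for k
    using min that by (simp add: min_swap_def)
  have after: "g k \<le> g p" if k: "n \<le> j" "j < k" "k < N" for k
  proof (rule ccontr)
    assume "\<not> ?thesis"
    then have gk: "?v \<le> g (Suc j)"
      using g'[of "Suc j" k] k by simp
    have "g (Suc j) \<le> g j" "g (Suc j) \<noteq> g j"
      using g'[of j "Suc j"] distinct[of "Suc j" j] k gk by auto
    then have "\<not> rk g (Suc j) ?v < rk h (Suc j) ?v"
      using minD[of "Suc j"] gk k by linarith
    moreover have "rk g j ?v < rk h j ?v"
      using min by (simp add: min_swap_def)
    ultimately have hj: "\<not> ?v \<le> h j" "rk h (Suc j) ?v \<le> rk g (Suc j) ?v"
      using pj by (auto split: if_splits)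
    have "\<not> ?v \<le> h (Suc j)"
      using hj(1) h'[of j "Suc j"] k by simp
    then have "rk h (Suc (Suc j)) ?v < rk g (Suc (Suc j)) ?v"
      using gk hj(2) by (auto simp del: rk_Suc simp: rk_Suc[of _ "Suc j"])
    then show False
      using le'[of "Suc (Suc j)" ?v] k by (simp del: rk_Suc)
  qed
  show ?thesis
  proof (rule monotone_onI)
    fix k l assume kl: "k \<in> {n..<N}" "l \<in> {n..<N}" "k \<le> l"
    then show "swap g p j l \<le> swap g p j k"
      using p pj after[of l] g'[of k l] g'[of k j] by (cases "l = j"; cases "k = j") auto
  qed
qed

text \<open>The corner of the rectangle raised by a swap must be a deficit of \<open>g\<close>. This
  excludes levels up to \<open>g p\<close>, and if \<open>g q = g p\<close> then \<open>l\<close>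
  competes with \<open>j\<close> for the minimal value.\<close>

lemma min_swap_least:
  assumes min: "min_swap N g h p j"
    and cover: "cover_swap N g q l" and le: "rk_le N (swap g q l) h"
  shows "(g p, g j) \<le> (g q, g l)"
proof -
  have ql: "q < l" "l < N" "g q < g l"
    using cover by (auto simp: cover_swap_def)
  have lt: "rk g l (Suc (g q)) < rk h l (Suc (g q))"
    by (rule rk_swap_rectangle[OF cover le]) (use ql in auto)
  have "g p \<le> g q"
  proof (rule ccontr)
    assume "\<not> ?thesis"
    then have "rk g l (Suc (g q)) = rk h l (Suc (g q))"
      using min ql by (simp add: min_swap_def)
    then show False
      using lt by simp
  qed
  moreover have "g j \<le> g l" if "g q = g p"
    using that min lt ql by (simp add: min_swap_def)
  ultimately show ?thesis
    by (cases "g q = g p") auto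
qed

lemma cover_swap_inject:
  assumes "cover_swap N g p j" "cover_swap N g q l" "g p = g q" "j = l"
  shows "p = q"
  using assms by (metis cover_swap_def less_le_not_le linorder_neqE_nat order_refl)

text \<open>The first swap only raises counts, so a deficit left after it was already a deficit of
  \<open>g\<close>, and the minimal choice of \<open>g p\<close> and \<open>g j\<close> applies
  again. If \<open>l = p\<close>, the value moved is \<open>g j\<close> itself.\<close>

lemma min_swap_next_label:
  assumes min: "min_swap N g h p j" and cover: "cover_swap N (swap g p j) q l"
    and le: "rk_le N (swap (swap g p j) q l) h"
  shows "(g p, g j) \<le> (swap g p j q, swap g p j l)"
proof -
  let ?g = "swap g p j"
  have pj: "p < j" "j < N" "g p < g j"
    using min by (auto simp: min_swap_def cover_swap_def)
  have ql: "q < l" "l < N" "?g q < ?g l"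
    using cover by (auto simp: cover_swap_def)
  have lt: "rk ?g l (Suc (?g q)) < rk h l (Suc (?g q))"
    by (rule rk_swap_rectangle[OF cover le]) (use ql in auto)
  then have lt': "rk g l (Suc (?g q)) < rk h l (Suc (?g q))"
    using pj by (simp add: rk_swap split: if_splits)
  have ge: "g p \<le> ?g q"
  proof (rule ccontr)
    assume "\<not> ?thesis"
    then have "rk g l (Suc (?g q)) = rk h l (Suc (?g q))"
      using min ql by (simp add: min_swap_def)
    then show False
      using lt' by simp
  qed
  show ?thesis
  proof (cases "?g q = g p")
    case True
    then have "l \<noteq> j"
      using ql by auto
    then have "g j \<le> ?g l"
      using min lt' ql True by (cases "l = p") (auto simp: min_swap_def)
    then show ?thesis
      using True by simp
  qed (use ge in auto)
qed

section \<open>A criterion for EL-labelings\<close>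

lemma maximal_chains_iff:
  "c \<in> maximal_chains P r x y \<longleftrightarrow>
    c = [x] \<and> x = y \<or>
    (\<exists>z d. c = x # d \<and> (x, z) \<in> covers P r \<and> d \<in> maximal_chains P r z y)"
proof (cases c)
  case (Cons a d)
  then show ?thesis
    by (cases d) (auto simp: maximal_chains_def)
qed (auto simp: maximal_chains_def)

lemma jordan_holder_Cons:
  "d \<in> maximal_chains P r z y \<Longrightarrow> jordan_holder f (x # d) = f (x, z) # jordan_holder f d"
  by (cases d) (auto simp: maximal_chains_def jordan_holder_def)

text \<open>Each covering raises the rank by one, so all maximal chains of an interval have label
  sequences of the same length.\<close>

lemma maximal_chains_rank:
  assumes "partial_order_on P r" "rank_function P r \<rho>"
    and "c \<in> maximal_chains P r x y" "x \<in> P"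
  shows "(x, y) \<in> r \<and> \<rho> y = \<rho> x + length (jordan_holder f c)"
  using assms(3,4)
proof (induction c arbitrary: x)
  case Nil
  then show ?case
    by (simp add: maximal_chains_def)
next
  case (Cons a d)
  show ?case
  proof (cases "d = []")
    case True
    then show ?thesis
      using Cons.prems partial_order_onD(1)[OF assms(1)]
      by (auto simp: maximal_chains_def jordan_holder_def refl_on_def)
  next
    case False
    then obtain z where z: "(x, z) \<in> covers P r" "d \<in> maximal_chains P r z y" "a = x"
      using Cons.prems(1) by (subst (asm) maximal_chains_iff) auto
    have "(x, z) \<in> r" "z \<in> P" "\<rho> z = Suc (\<rho> x)"
      using z(1) assms(2) by (auto simp: covers_def rank_function_def)
    then show ?thesis
      using Cons.IH[OF z(2)] z partial_order_onD(2)[OF assms(1)] jordan_holder_Cons[OF z(2), of f] by (auto dest: transD)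
  qed
qed

lemma lex_le_Cons:
  "length s = length t \<Longrightarrow> lex_le (a # s) (b # t) \<longleftrightarrow> a < b \<or> a = b \<and> lex_le s t"
  by (auto simp: lex_le_def)

text \<open>A greedy criterion. The first step \<open>z\<close> has the strictly least label
  available, so continuing from it is lexicographically least; the following labels are no smaller,
  so the chain is increasing; every increasing chain passes through \<open>z\<close>, so uniqueness
  follows by induction on the rank difference.\<close>

lemma EL_labelingI:
  fixes f :: "'a \<times> 'a \<Rightarrow> 'c::linorder"
  assumes po: "partial_order_on P r" and rank: "rank_function P r \<rho>"
    and range: "f \<in> covers P r \<rightarrow> \<Gamma>"
    and step: "\<And>x y. x \<in> P \<Longrightarrow> y \<in> P \<Longrightarrow> (x, y) \<in> r \<Longrightarrow> x \<noteq> y \<Longrightarrow>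
      \<exists>z. (x, z) \<in> covers P r \<and> (z, y) \<in> r \<and>
        (\<forall>z'. (x, z') \<in> covers P r \<and> (z', y) \<in> r \<and> z' \<noteq> z \<longrightarrow> f (x, z) < f (x, z')) \<and>
        (\<forall>z'. (z, z') \<in> covers P r \<and> (z', y) \<in> r \<longrightarrow> f (x, z) \<le> f (z, z')) \<and>
        (\<forall>c \<in> maximal_chains P r x y. sorted (jordan_holder f c) \<longrightarrow> hd (tl c) = z)"
  shows "EL_labeling P r \<Gamma> f"
proof -
  let ?M = "maximal_chains P r" and ?J = "jordan_holder f"
  have covers: "z \<in> P" "(x, z) \<in> r" "x \<noteq> z" "\<rho> z = Suc (\<rho> x)" if "(x, z) \<in> covers P r" for x z
    using that rank by (auto simp: covers_def rank_function_def)
  have chain: "(x, y) \<in> r" "\<rho> y = \<rho> x + length (?J c)" if "c \<in> ?M x y" "x \<in> P" for c x y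
    using maximal_chains_rank[OF po rank that] by auto
  have trivial: "c = [x]" if "c \<in> ?M x x" "x \<in> P" for c x
    using chain(2)[OF that] that(1) jordan_holder_Cons[of _ P r _ x f x]
    unfolding maximal_chains_iff[of c] by (elim disjE exE conjE) simp_all
  \<comment> \<open>Existence, uniqueness and minimality go through the induction together, with the
    one-element chain as base.\<close>
  have main: "\<exists>c \<in> ?M x y. sorted (?J c) \<and>
      (\<forall>d \<in> ?M x y. (sorted (?J d) \<longrightarrow> d = c) \<and> lex_le (?J c) (?J d))"
    if "x \<in> P" "y \<in> P" "(x, y) \<in> r" for x y
    using that
  proof (induction "\<rho> y - \<rho> x" arbitrary: x rule: less_induct)
    case less
    show ?case
    proof (cases "x = y")
      case True
      have "[x] \<in> ?M x x"
        by (simp add: maximal_chains_def)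
      moreover have "sorted (?J [x])"
        by (simp add: jordan_holder_def)
      moreover have "d = [x]" if "d \<in> ?M x y" for d
        using trivial that True less.prems(1) by blast
      ultimately show ?thesis
        using True unfolding lex_le_def by metis
    next
      case False
      obtain z where z: "(x, z) \<in> covers P r" "(z, y) \<in> r"
        and least: "\<And>z'. (x, z') \<in> covers P r \<Longrightarrow> (z', y) \<in> r \<Longrightarrow> z' \<noteq> z \<Longrightarrow> f (x, z) < f (x, z')"
        and after: "\<And>z'. (z, z') \<in> covers P r \<Longrightarrow> (z', y) \<in> r \<Longrightarrow> f (x, z) \<le> f (z, z')"
        and sorted: "\<And>c. c \<in> ?M x y \<Longrightarrow> sorted (?J c) \<Longrightarrow> hd (tl c) = z"
        using step[OF less.prems False] by blast
      have "\<rho> x < \<rho> y"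
        using rank less.prems False by (auto simp: rank_function_def)
      then have "\<rho> y - \<rho> z < \<rho> y - \<rho> x"
        using covers(4)[OF z(1)] by simp
      from less.hyps[OF this covers(1)[OF z(1)] less.prems(2) z(2)]
      obtain c where c: "c \<in> ?M z y" "sorted (?J c)"
        and c_unique: "\<And>d. d \<in> ?M z y \<Longrightarrow> sorted (?J d) \<Longrightarrow> d = c"
        and c_least: "\<And>d. d \<in> ?M z y \<Longrightarrow> lex_le (?J c) (?J d)"
        by blast
      have xc: "x # c \<in> ?M x y"
        using z(1) c(1) by (subst maximal_chains_iff) blast
      have split: "\<exists>z' d'. d = x # d' \<and> (x, z') \<in> covers P r \<and> d' \<in> ?M z' y" if "d \<in> ?M x y" for d
        using that False by (subst (asm) maximal_chains_iff) blast
      have "sorted (?J (x # c))"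
      proof (cases "z = y")
        case True
        then have "c = [y]"
          using trivial c(1) less.prems(2) by blast
        then show ?thesis
          by (simp add: jordan_holder_def)
      next
        case zy: False
        then obtain z' c' where "c = z # c'" "(z, z') \<in> covers P r" "c' \<in> ?M z' y"
          using c(1) by (subst (asm) maximal_chains_iff) blast
        then show ?thesis
          using after[of z'] chain(1)[of c' z' y] covers(1)[of z z'] c
          by (auto simp: jordan_holder_Cons)
      qed
      moreover have "d = x # c" if d: "d \<in> ?M x y" "sorted (?J d)" for d
      proof -
        obtain z' d' where d': "d = x # d'" "d' \<in> ?M z' y"
          using split[OF d(1)] by blast
        then have "z' = z"
          using sorted[OF d] by (simp add: maximal_chains_def)
        then show ?thesis
          using c_unique[of d'] d d' by (auto simp: jordan_holder_Cons)
      qed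
      moreover have "lex_le (?J (x # c)) (?J d)" if d: "d \<in> ?M x y" for d
      proof -
        obtain z' d' where d': "d = x # d'" "(x, z') \<in> covers P r" "d' \<in> ?M z' y"
          using split[OF d] by blast
        \<comment> \<open>\<open>lex\<close> relates only lists of equal length, so the rank has to
          rule out a difference in length.\<close>
        have len: "length (?J c) = length (?J d')"
          using chain(2)[OF c(1)] chain(2)[OF d'(3)] covers[OF z(1)] covers[OF d'(2)] by simp
        show ?thesis
          using least[OF d'(2)] chain(1)[OF d'(3)] covers(1)[OF d'(2)] c_least[of d'] d' c(1)
          by (cases "z' = z") (auto simp: jordan_holder_Cons lex_le_Cons len)
      qed
      ultimately show ?thesis
        using xc by blast
    qed
  qed
  have "graded_poset P r"
    using po rank by (auto simp: graded_poset_def)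
  moreover have "(\<exists>!c. c \<in> ?M x y \<and> sorted (?J c)) \<and>
      (\<forall>c \<in> ?M x y. sorted (?J c) \<longrightarrow> (\<forall>d \<in> ?M x y. lex_le (?J c) (?J d)))"
    if "x \<in> P" "y \<in> P" "(x, y) \<in> r" for x y
    using main[OF that] by blast
  ultimately show ?thesis
    using range by (simp add: EL_labeling_def)
qed

section \<open>Rook words\<close>

definition rook_words :: "nat \<Rightarrow> nat list set" where
  "rook_words n = {a. length a = n \<and> set a \<subseteq> {..n} \<and>
     (\<forall>i<n. \<forall>j<n. a ! i = a ! j \<and> 0 < a ! i \<longrightarrow> i = j)}"

lemma rook_word_length [simp]: "x \<in> rook_monoid n \<Longrightarrow> length (rook_word x) = n"
  by (auto simp: rook_word_def rook_monoid_def)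

lemma rook_monoid_dim: "x \<in> rook_monoid n \<Longrightarrow> dim_row x = n \<and> dim_col x = n"
  by (auto simp: rook_monoid_def)

lemma rook_monoid_entries:
  assumes "x \<in> rook_monoid n"
  shows "i < n \<Longrightarrow> j < n \<Longrightarrow> x $$ (i, j) = 0 \<or> x $$ (i, j) = 1"
    and "i < n \<Longrightarrow> j < n \<Longrightarrow> k < n \<Longrightarrow> x $$ (i, j) = 1 \<Longrightarrow> x $$ (i, k) = 1 \<Longrightarrow> j = k"
    and "j < n \<Longrightarrow> i < n \<Longrightarrow> k < n \<Longrightarrow> x $$ (i, j) = 1 \<Longrightarrow> x $$ (k, j) = 1 \<Longrightarrow> i = k"
proof -
  have unique: "a = b" if "card A \<le> 1" "finite A" "a \<in> A" "b \<in> A" for A :: "nat set" and a b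
    using that card_le_Suc0_iff_eq[OF that(2)] by auto
  show "x $$ (i, j) = 0 \<or> x $$ (i, j) = 1" if "i < n" "j < n"
    using assms that by (simp add: rook_monoid_def)
  show "j = k" if "i < n" "j < n" "k < n" "x $$ (i, j) = 1" "x $$ (i, k) = 1"
    using assms that by (intro unique[of "{j. j < n \<and> x $$ (i, j) = 1}"]) (auto simp: rook_monoid_def)
  show "i = k" if "j < n" "i < n" "k < n" "x $$ (i, j) = 1" "x $$ (k, j) = 1"
    using assms that by (intro unique[of "{i. i < n \<and> x $$ (i, j) = 1}"]) (auto simp: rook_monoid_def)
qed

lemma rook_word_nth_iff:
  assumes x: "x \<in> rook_monoid n" and "i < n" "j < n"
  shows "rook_word x ! j = Suc i \<longleftrightarrow> x $$ (i, j) = 1"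
proof -
  have dim: "dim_row x = n" "dim_col x = n"
    using rook_monoid_dim[OF x] by simp_all
  have the: "(THE i. i < n \<and> x $$ (i, j) = 1) = k" if "k < n" "x $$ (k, j) = 1" for k
    using rook_monoid_entries(3)[OF x assms(3) _ that(1) _ that(2)] that by blast
  show ?thesis
    using assms(2,3) dim the by (auto simp: rook_word_def)
qed

lemma rook_word_nth_le:
  assumes "x \<in> rook_monoid n" "j < n"
  shows "rook_word x ! j \<le> n"
proof (cases "rook_word x ! j = 0")
  case False
  have dim: "dim_row x = n" "dim_col x = n"
    using rook_monoid_dim[OF assms(1)] by simp_all
  then obtain i where i: "i < n" "x $$ (i, j) = 1"
    using False assms(2) by (auto simp: rook_word_def split: if_splits)
  then show ?thesis
    using rook_word_nth_iff[OF assms(1) i(1) assms(2)] by simp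
qed simp

text \<open>The column condition gives each position a single letter, and the row condition makes
  nonzero letters distinct. Conversely, a word yields the matrix with a 1 in row \<open>i\<close>
  exactly where the letter is \<open>Suc i\<close>.\<close>

lemma bij_betw_rook_word: "bij_betw rook_word (rook_monoid n) (rook_words n)"
proof (rule bij_betwI')
  fix x y assume x: "x \<in> rook_monoid n" and y: "y \<in> rook_monoid n"
  have "x = y" if eq: "rook_word x = rook_word y"
  proof (rule eq_matI)
    fix i j assume "i < dim_row y" "j < dim_col y"
    then have ij: "i < n" "j < n"
      using rook_monoid_dim[OF y] by simp_all
    then have "x $$ (i, j) = 1 \<longleftrightarrow> y $$ (i, j) = 1"
      using eq rook_word_nth_iff[OF x ij] rook_word_nth_iff[OF y ij] by simp
    then show "x $$ (i, j) = y $$ (i, j)"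
      using rook_monoid_entries(1)[OF x ij] rook_monoid_entries(1)[OF y ij] by auto
  qed (use rook_monoid_dim[OF x] rook_monoid_dim[OF y] in simp_all)
  then show "rook_word x = rook_word y \<longleftrightarrow> x = y"
    by blast
next
  fix x assume x: "x \<in> rook_monoid n"
  have "i = j" if ij: "i < n" "j < n" "rook_word x ! i = rook_word x ! j" "0 < rook_word x ! i" for i j
  proof -
    obtain k where k: "rook_word x ! i = Suc k"
      using ij(4) by (cases "rook_word x ! i") auto
    then have "k < n"
      using rook_word_nth_le[OF x ij(1)] by simp
    have "x $$ (k, i) = 1" "x $$ (k, j) = 1"
      using rook_word_nth_iff[OF x \<open>k < n\<close>] ij k by metis+
    then show ?thesis
      using rook_monoid_entries(2)[OF x \<open>k < n\<close> ij(1,2)] by blast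
  qed
  then show "rook_word x \<in> rook_words n"
    using x rook_word_nth_le[OF x] by (auto simp: rook_words_def in_set_conv_nth)
next
  fix a assume a: "a \<in> rook_words n"
  define x where "x = mat n n (\<lambda>(i, j). if a ! j = Suc i then 1 else 0 :: nat)"
  have inj: "i = j" if "i < n" "j < n" "a ! i = a ! j" "0 < a ! i" for i j
    using a that by (simp add: rook_words_def)
  have x_entry: "x $$ (i, j) = 1 \<longleftrightarrow> a ! j = Suc i" if "i < n" "j < n" for i j
    using that by (simp add: x_def)
  have "card {j. j < n \<and> x $$ (i, j) = 1} \<le> Suc 0" if "i < n" for i
  proof (subst card_le_Suc0_iff_eq, simp, intro ballI)
    fix j k assume "j \<in> {j. j < n \<and> x $$ (i, j) = 1}" "k \<in> {j. j < n \<and> x $$ (i, j) = 1}"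
    then have "j < n" "k < n" "a ! j = Suc i" "a ! k = Suc i"
      using x_entry[of i j] x_entry[of i k] that by auto
    then show "j = k"
      using inj[of j k] by simp
  qed
  moreover have "card {i. i < n \<and> x $$ (i, j) = 1} \<le> Suc 0" if "j < n" for j
  proof (subst card_le_Suc0_iff_eq, simp, intro ballI)
    fix i k assume "i \<in> {i. i < n \<and> x $$ (i, j) = 1}" "k \<in> {i. i < n \<and> x $$ (i, j) = 1}"
    then have "a ! j = Suc i" "a ! j = Suc k"
      using x_entry[of i j] x_entry[of k j] that by auto
    then show "i = k"
      by simp
  qed
  ultimately have x: "x \<in> rook_monoid n"
    by (simp add: rook_monoid_def) (simp add: x_def)
  have "a = rook_word x"
  proof (rule nth_equalityI)
    show "length a = length (rook_word x)"
      using a x by (simp add: rook_words_def)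
    fix j assume j: "j < length a"
    then have j: "j < n" "a ! j \<le> n"
      using a by (auto simp: rook_words_def subset_iff)
    have iff: "rook_word x ! j = Suc i \<longleftrightarrow> a ! j = Suc i" if "i < n" for i
      using rook_word_nth_iff[OF x that j(1)] that j(1) by (simp add: x_def)
    show "a ! j = rook_word x ! j"
      using iff j(2) rook_word_nth_le[OF x j(1)]
      by (cases "a ! j"; cases "rook_word x ! j") (auto simp: Suc_le_eq)
  qed
  then show "\<exists>x \<in> rook_monoid n. a = rook_word x"
    using x by blast
qed

text \<open>A rook word is continued to the right by the values it does not use, in decreasing order,
  where \<open>0\<close> is available \<open>n\<close> times and each of \<open>1, \<dots>, n\<close> once. Coverings of type 1 then become
  swaps of two entries, like those of type 2.\<close>

definition rook_functions :: "nat \<Rightarrow> (nat \<Rightarrow> nat) set" where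
  "rook_functions n = {g. (\<forall>k\<ge>2 * n. g k = 0) \<and> antimono_on {n..<2 * n} g \<and>
     (\<forall>u>0. rk g (2 * n) u = Suc n - u)}"

lemma rk_total_eq:
  "g \<in> rook_functions n \<Longrightarrow> h \<in> rook_functions n \<Longrightarrow> rk g (2 * n) u = rk h (2 * n) u"
  by (cases "u = 0") (auto simp: rook_functions_def)

lemma rook_functions_le:
  assumes "g \<in> rook_functions n"
  shows "g k \<le> n"
proof (cases "k < 2 * n")
  case True
  have "rk g (2 * n) (Suc n) = 0"
    using assms by (simp add: rook_functions_def)
  then have "k \<notin> {k. k < 2 * n \<and> Suc n \<le> g k}"
    unfolding rk_def by (subst (asm) card_0_eq) auto
  then show ?thesis
    using True by simp
qed (use assms in \<open>simp add: rook_functions_def\<close>)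

text \<open>A repeated positive value would make the counts at two consecutive levels differ by at
  least 2, but the prescribed counts \<open>Suc n - u\<close> drop by at most 1.\<close>

lemma rook_functions_distinct:
  assumes g: "g \<in> rook_functions n" and "k < 2 * n" "l < 2 * n" "g k = g l" "0 < g k"
  shows "k = l"
proof (rule ccontr)
  assume "k \<noteq> l"
  let ?A = "\<lambda>u. {k. k < 2 * n \<and> u \<le> g k}"
  have "?A (Suc (g k)) \<union> {k, l} \<subseteq> ?A (g k)"
    using assms by auto
  then have "card (?A (Suc (g k)) \<union> {k, l}) \<le> card (?A (g k))"
    by (intro card_mono) auto
  moreover have "card (?A (Suc (g k)) \<union> {k, l}) = card (?A (Suc (g k))) + 2"
    using \<open>k \<noteq> l\<close> assms by (subst card_Un_disjoint) auto
  ultimately have "rk g (2 * n) (Suc (g k)) + 2 \<le> rk g (2 * n) (g k)"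
    by (simp add: rk_def)
  then show False
    using g assms by (simp add: rook_functions_def)
qed

text \<open>The decreasing tail adds no condition: while \<open>h\<close> stays at \<open>u\<close>
  or above it gains at every position, and once it falls below \<open>u\<close> it has reached its
  total, which is also the total of \<open>g\<close>.\<close>

lemma rk_le_rook_functions:
  assumes g: "g \<in> rook_functions n" and h: "h \<in> rook_functions n"
    and le: "\<And>i u. i \<le> n \<Longrightarrow> rk g i u \<le> rk h i u"
  shows "rk_le (2 * n) g h"
  unfolding rk_le_def
proof (intro allI impI)
  fix i u assume i: "i \<le> 2 * n"
  show "rk g i u \<le> rk h i u"
  proof (cases "i \<le> n")
    case False
    show ?thesis
    proof (cases "\<forall>k. n \<le> k \<and> k < i \<longrightarrow> u \<le> h k")
      case True
      \<comment> \<open>At level 0 the count is the position, so \<open>h\<close> gains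
        \<open>i - n\<close> after the first \<open>n\<close> positions, the largest possible
        gain.\<close>
      have "rk h i u + rk h n 0 = rk h i 0 + rk h n u"
        by (rule rk_bound_eq) (use True False in auto)
      then show ?thesis
        using rk_index_bound[of n i g u] le[of n u] False by simp
    next
      case ex: False
      then obtain k where k: "n \<le> k" "k < i" "h k < u"
        by (auto simp: not_le)
      \<comment> \<open>The level \<open>Suc n + u\<close> is at least \<open>u\<close>, as
        \<open>rk_bound_eq\<close> demands, and exceeds all values, so its counts vanish. The
        equation then says that no entry from \<open>i\<close> on reaches \<open>u\<close>.\<close>
      have "rk h (2 * n) (Suc n + u) + rk h i u = rk h (2 * n) u + rk h i (Suc n + u)"
      proof (rule rk_bound_eq)
        fix m assume m: "i \<le> m" "m < 2 * n" "u \<le> h m"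
        then have "h m \<le> h k"
          using h k by (auto simp: rook_functions_def monotone_on_def)
        then show "Suc n + u \<le> h m"
          using k m by simp
      qed (use i in auto)
      moreover have "rk h (2 * n) (Suc n + u) = 0" "rk h i (Suc n + u) = 0"
        using rook_functions_le[OF h] by (auto simp: rk_def not_le intro!: le_imp_less_Suc trans_le_add1)
      ultimately show ?thesis
        using rk_total_eq[OF g h, of u] rk_index_mono[OF i, of g u] by simp
    qed
  qed (use le in simp)
qed

section \<open>The count order on rook functions\<close>

lemma rk_le_refl: "rk_le N g g"
  by (simp add: rk_le_def)

lemma rk_le_trans: "rk_le N f g \<Longrightarrow> rk_le N g h \<Longrightarrow> rk_le N f h"
  unfolding rk_le_def by (meson order_trans)

lemma rk_le_antisym:
  assumes "g \<in> rook_functions n" "h \<in> rook_functions n" "rk_le (2 * n) g h" "rk_le (2 * n) h g"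
  shows "g = h"
proof
  fix k
  have "\<forall>i\<le>2 * n. \<forall>u. rk g i u = rk h i u"
    using assms(3,4) unfolding rk_le_def by (meson order_antisym)
  then show "g k = h k"
  proof (cases "k < 2 * n")
    case True
    with \<open>\<forall>i\<le>2 * n. \<forall>u. rk g i u = rk h i u\<close> show ?thesis
      by (rule rk_eq_imp_eq)
  qed (use assms in \<open>simp add: rook_functions_def\<close>)
qed

text \<open>The total counts are untouched because \<open>j\<close> lies below \<open>2 * n\<close>;
  that the tail stays decreasing comes from the greedy choice.\<close>

lemma rook_functions_swap:
  assumes g: "g \<in> rook_functions n" and h: "h \<in> rook_functions n"
    and le: "rk_le (2 * n) g h" and min: "min_swap (2 * n) g h p j"
  shows "swap g p j \<in> rook_functions n"
proof -
  have pj: "p < j" "j < 2 * n" "g p < g j"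
    using min by (auto simp: min_swap_def cover_swap_def)
  have "antimono_on {n..<2 * n} (swap g p j)"
  proof (rule antimono_tail_swap[OF min le _ _ rook_functions_distinct[OF g]])
    show "antimono_on {n..<2 * n} g" "antimono_on {n..<2 * n} h"
      using g h by (simp_all add: rook_functions_def)
  qed
  moreover have "rk (swap g p j) (2 * n) u = rk g (2 * n) u" for u
    using pj by (simp add: rk_swap)
  moreover have "swap g p j k = 0" if "2 * n \<le> k" for k
    using g pj that by (simp add: rook_functions_def swap_def)
  ultimately show ?thesis
    using g by (simp add: rook_functions_def)
qed

section \<open>Extension of rook words and its uniqueness\<close>

lemma rk_nth: "rk ((!) l) (length l) u = length (filter (\<lambda>x. u \<le> x) l)"
  by (simp add: rk_def length_filter_conv_card)

lemma rook_functions_extend: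
  assumes a: "a \<in> rook_words n"
  shows "\<exists>g \<in> rook_functions n. map g [0..<n] = a"
proof -
  define v where "v = replicate n 0 @ [Suc 0..<Suc n]"
  define t where "t = rev (sorted_list_of_multiset (mset v - mset a))"
  define l where "l = a @ t"
  have len_a: "length a = n"
    using a by (simp add: rook_words_def)
  have "count (mset a) x \<le> count (mset v) x" for x
  proof -
    consider "x = 0" | "0 < x" "x \<in> set a" | "x \<notin> set a"
      by blast
    then show ?thesis
    proof cases
      case 1
      have "count (mset v) 0 = n"
        by (simp add: v_def)
      then show ?thesis
        using 1 len_a count_le_length[of a 0] by (simp add: count_mset)
    next
      case 2
      have "card {i. i < n \<and> x = a ! i} \<le> Suc 0"
        using a 2(1) by (subst card_le_Suc0_iff_eq) (auto simp: rook_words_def)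
      then have "count (mset a) x \<le> 1"
        using len_a by (simp add: count_mset count_list_eq_length_filter length_filter_conv_card)
      moreover have "x \<in> set v"
        using 2 a by (auto simp: v_def rook_words_def)
      then have "1 \<le> count (mset v) x"
        by (simp add: Suc_le_eq)
      ultimately show ?thesis
        by (rule order_trans)
    next
      case 3
      then have "count (mset a) x = 0"
        by (metis count_eq_zero_iff set_mset_mset)
      then show ?thesis
        by linarith
    qed
  qed
  then have "mset a \<subseteq># mset v"
    by (rule mset_subset_eqI)
  then have mset_l: "mset l = mset v"
    by (simp add: l_def t_def)
  then have "length l = length v"
    by (metis size_mset)
  then have len: "length l = 2 * n"
    by (simp add: v_def)
  define g where "g = (\<lambda>k. if k < 2 * n then l ! k else 0)"
  have "rk g (2 * n) u = Suc n - u" if "0 < u" for u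
  proof -
    have "rk g (2 * n) u = rk ((!) l) (length l) u"
      unfolding len by (rule rk_cong) (simp add: g_def)
    also have "\<dots> = length (filter (\<lambda>x. u \<le> x) v)"
      unfolding rk_nth using mset_l by (metis mset_filter size_mset)
    also have "\<dots> = length (filter (\<lambda>x. u \<le> x) [Suc 0..<Suc n])"
      using that by (simp add: v_def)
    also have "\<dots> = card (set (filter (\<lambda>x. u \<le> x) [Suc 0..<Suc n]))"
      by (rule distinct_card[symmetric]) simp
    also have "set (filter (\<lambda>x. u \<le> x) [Suc 0..<Suc n]) = {u..n}"
      using that by auto
    finally show ?thesis
      by simp
  qed
  moreover have "antimono_on {n..<2 * n} g"
  proof (rule monotone_onI)
    fix i k assume "i \<in> {n..<2 * n}" "k \<in> {n..<2 * n}" "i \<le> k"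
    moreover have "sorted (rev t)"
      by (simp add: t_def)
    ultimately show "g k \<le> g i"
      using len len_a sorted_rev_nth_mono[of t "i - n" "k - n"]
      by (auto simp: g_def l_def nth_append)
  qed
  ultimately have "g \<in> rook_functions n"
    by (auto simp: rook_functions_def g_def)
  moreover have "map g [0..<n] = a"
    using len_a by (auto intro!: nth_equalityI simp: g_def l_def nth_append)
  ultimately show ?thesis
    by blast
qed

text \<open>The choice is harmless: rook functions that agree on the first \<open>n\<close>
  positions are equal, by \<open>rk_le_rook_functions\<close> and
  \<open>rk_le_antisym\<close>.\<close>

definition rook_embedding :: "nat \<Rightarrow> nat mat \<Rightarrow> nat \<Rightarrow> nat" where
  "rook_embedding n x = (SOME g. g \<in> rook_functions n \<and> map g [0..<n] = rook_word x)"

lemma rook_embedding: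
  assumes "x \<in> rook_monoid n"
  shows "rook_embedding n x \<in> rook_functions n" "map (rook_embedding n x) [0..<n] = rook_word x"
proof -
  have "rook_word x \<in> rook_words n"
    using bij_betw_rook_word assms by (rule bij_betw_apply)
  then have "\<exists>g. g \<in> rook_functions n \<and> map g [0..<n] = rook_word x"
    using rook_functions_extend by blast
  from someI_ex[OF this]
  show "rook_embedding n x \<in> rook_functions n" "map (rook_embedding n x) [0..<n] = rook_word x"
    by (simp_all add: rook_embedding_def)
qed

lemma rook_word_nth:
  assumes "x \<in> rook_monoid n" "k < n"
  shows "rook_word x ! k = rook_embedding n x k"
proof -
  have "rook_word x ! k = map (rook_embedding n x) [0..<n] ! k"
    by (simp only: rook_embedding(2)[OF assms(1)])
  then show ?thesis
    using assms(2) by simp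
qed

lemma rook_embedding_inject:
  assumes "x \<in> rook_monoid n" "y \<in> rook_monoid n" "rook_embedding n x = rook_embedding n y"
  shows "x = y"
proof (rule inj_onD[OF bij_betw_imp_inj_on[OF bij_betw_rook_word] _ assms(1,2)])
  show "rook_word x = rook_word y"
    using rook_embedding(2)[OF assms(1)] rook_embedding(2)[OF assms(2)] assms(3) by simp
qed

lemma rook_functions_restrict:
  assumes g: "g \<in> rook_functions n"
  shows "map g [0..<n] \<in> rook_words n"
proof -
  have "i = j" if "i < n" "j < n" "g i = g j \<and> 0 < g i" for i j
    by (rule rook_functions_distinct[OF g]) (use that in auto)
  then show ?thesis
    using rook_functions_le[OF g] by (simp add: rook_words_def image_subset_iff)
qed

lemma rook_embedding_surj:
  assumes g: "g \<in> rook_functions n"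
  obtains x where "x \<in> rook_monoid n" "rook_embedding n x = g"
proof -
  have "map g [0..<n] \<in> rook_word ` rook_monoid n"
    using bij_betw_imp_surj_on[OF bij_betw_rook_word[of n]] rook_functions_restrict[OF g] by simp
  then obtain x where x: "x \<in> rook_monoid n" "rook_word x = map g [0..<n]"
    by (metis imageE)
  have agree: "rook_embedding n x k = g k" if "k < n" for k
    using rook_word_nth[OF x(1) that] x(2) that by simp
  \<comment> \<open>Equal counts up to \<open>n\<close> give the comparison in both directions,
    hence equality of the whole functions.\<close>
  have "rk (rook_embedding n x) i u = rk g i u" if "i \<le> n" for i u
    by (rule rk_cong) (use agree that in simp)
  then have "rook_embedding n x = g"
    using rook_embedding(1)[OF x(1)] g by (intro rk_le_antisym[of _ n] rk_le_rook_functions) simp_all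
  then show ?thesis
    using x(1) that by blast
qed

section \<open>The Bruhat--Chevalley--Renner order\<close>

text \<open>An explicit description of the Bruhat--Chevalley--Renner order, identified with it in
  \<open>bruhat_le_eq\<close>.\<close>

definition rk_order :: "nat \<Rightarrow> nat mat rel" where
  "rk_order n = {(x, y). x \<in> rook_monoid n \<and> y \<in> rook_monoid n \<and>
     rk_le (2 * n) (rook_embedding n x) (rook_embedding n y)}"

lemma partial_order_rk_order: "partial_order_on (rook_monoid n) (rk_order n)"
proof -
  have "antisym (rk_order n)"
  proof (rule antisymI)
    fix x y assume "(x, y) \<in> rk_order n" "(y, x) \<in> rk_order n"
    then show "x = y"
      using rk_le_antisym rook_embedding(1) rook_embedding_inject unfolding rk_order_def by blast
  qed
  moreover have "trans (rk_order n)"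
    by (rule transI) (clarsimp simp: rk_order_def, erule (1) rk_le_trans)
  ultimately show ?thesis
    by (auto simp: partial_order_on_def preorder_on_def refl_on_def rk_order_def rk_le_refl)
qed

lemma rk_mono:
  assumes "\<And>k. k < i \<Longrightarrow> g k \<le> h k"
  shows "rk g i u \<le> rk h i u"
  unfolding rk_def by (rule card_mono) (auto intro: order_trans[OF _ assms])

text \<open>It suffices to compare counts up to \<open>n\<close>, where the embeddings show the
  words themselves: there type 1 raises an entry and type 2 is a swap.\<close>

lemma bruhat_steps_subset: "bruhat_steps n \<subseteq> rk_order n"
proof
  fix e assume "e \<in> bruhat_steps n"
  then obtain x y where e: "e = (x, y)" and x: "x \<in> rook_monoid n" and y: "y \<in> rook_monoid n"
    and step: "(\<exists>i. type1 (rook_word x) (rook_word y) i) \<or>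
      (\<exists>i j. type2 (rook_word x) (rook_word y) i j)"
    unfolding bruhat_steps_def by blast
  let ?g = "rook_embedding n x" and ?h = "rook_embedding n y"
  note nth = rook_word_nth[OF x] rook_word_nth[OF y] rook_word_length[OF x] rook_word_length[OF y]
  have "rk ?g i u \<le> rk ?h i u" if i: "i \<le> n" for i u
    using step
  proof (elim disjE exE)
    fix p assume "type1 (rook_word x) (rook_word y) p"
    then have "?g k \<le> ?h k" if "k < n" for k
      using that by (cases "k = p") (auto simp: type1_def nth)
    then show ?thesis
      using i by (intro rk_mono) simp
  next
    fix p j assume t: "type2 (rook_word x) (rook_word y) p j"
    then have pj: "p < j" "j < n" "?g p < ?g j"
      by (auto simp: type2_def nth)
    have "?h k = swap ?g p j k" if "k < n" for k
      using t that pj by (cases "k = p"; cases "k = j") (auto simp: type2_def nth)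
    then have "rk ?h i u = rk (swap ?g p j) i u"
      using i by (intro rk_cong) simp
    then show ?thesis
      using pj by (simp add: rk_swap)
  qed
  then show "e \<in> rk_order n"
    using e x y rook_embedding(1) rk_le_rook_functions by (simp add: rk_order_def)
qed

section \<open>Unambiguity of the labels\<close>

lemma type1_unique:
  assumes "type1 a b i" "type1 a b j"
  shows "i = j"
proof (rule ccontr)
  assume "i \<noteq> j"
  then have "b ! i = a ! i" "a ! i < b ! i"
    using assms by (auto simp: type1_def)
  then show False
    by simp
qed

lemma type2_differ:
  assumes "type2 a b i j"
  shows "m < length a \<Longrightarrow> b ! m \<noteq> a ! m \<longleftrightarrow> m = i \<or> m = j" "i < j" "j < length a"
  using assms by (cases "m = i"; cases "m = j"; simp add: type2_def)+

lemma type2_unique: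
  assumes "type2 a b i j" "type2 a b k l"
  shows "i = k \<and> j = l"
  using type2_differ[OF assms(1)] type2_differ[OF assms(2)] by (metis less_asym less_trans)

lemma type1_not_type2:
  assumes "type1 a b m"
  shows "\<not> type2 a b i j"
proof
  assume t: "type2 a b i j"
  have "b ! i = a ! i \<or> b ! j = a ! j"
    using assms type2_differ(2,3)[OF t] by (cases "m = i") (simp_all add: type1_def)
  then show False
    using type2_differ(1)[OF t, of i] type2_differ(1)[OF t, of j] type2_differ(2,3)[OF t] by simp
qed

lemma rook_label_type1:
  assumes "type1 (rook_word x) (rook_word y) i"
  shows "rook_label (x, y) = (rook_word x ! i, rook_word y ! i)"
  unfolding rook_label_def Let_def prod.case
  using assms by (intro the_equality) (auto dest: type1_unique type1_not_type2)

lemma rook_label_type2: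
  assumes "type2 (rook_word x) (rook_word y) i j"
  shows "rook_label (x, y) = (rook_word x ! i, rook_word x ! j)"
  unfolding rook_label_def Let_def prod.case
  using assms by (intro the_equality) (auto dest: type2_unique type1_not_type2)

lemma swap_step:
  assumes x: "x \<in> rook_monoid n" and y: "y \<in> rook_monoid n"
    and eq: "rook_embedding n y = swap (rook_embedding n x) p j"
    and cover: "cover_swap (2 * n) (rook_embedding n x) p j"
  shows "(x, y) \<in> bruhat_steps n"
    and "rook_label (x, y) = (rook_embedding n x p, rook_embedding n x j)"
proof -
  let ?g = "rook_embedding n x"
  have pj: "p < j" "j < 2 * n" "?g p < ?g j"
    using cover by (auto simp: cover_swap_def)
  have "p < n"
  proof (rule ccontr)
    assume "\<not> ?thesis"
    then have "?g j \<le> ?g p"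
      using rook_embedding(1)[OF x] pj by (simp add: rook_functions_def monotone_on_def)
    then show False
      using pj by simp
  qed
  note nth = rook_word_nth[OF x] rook_word_nth[OF y] rook_word_length[OF x] rook_word_length[OF y]
  have "(x, y) \<in> bruhat_steps n \<and> rook_label (x, y) = (?g p, ?g j)"
  proof (cases "j < n")
    case True
    then have "type2 (rook_word x) (rook_word y) p j"
      using pj \<open>p < n\<close> by (simp add: type2_def nth eq)
    then show ?thesis
      using rook_label_type2 x y True \<open>p < n\<close> by (auto simp: bruhat_steps_def nth)
  next
    case False
    then have "type1 (rook_word x) (rook_word y) p"
      using pj \<open>p < n\<close> by (simp add: type1_def nth eq)
    then show ?thesis
      using rook_label_type1 x y \<open>p < n\<close> by (auto simp: bruhat_steps_def nth eq)
  qed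
  then show "(x, y) \<in> bruhat_steps n" "rook_label (x, y) = (?g p, ?g j)"
    by auto
qed

section \<open>Generation of the order by greedy swaps\<close>

lemma rk_order_min_swap:
  assumes xy: "(x, y) \<in> rk_order n" "x \<noteq> y"
  obtains z p j where "z \<in> rook_monoid n" "(z, y) \<in> rk_order n"
    "rook_embedding n z = swap (rook_embedding n x) p j"
    "min_swap (2 * n) (rook_embedding n x) (rook_embedding n y) p j"
proof -
  let ?g = "rook_embedding n x" and ?h = "rook_embedding n y"
  have x: "x \<in> rook_monoid n" and y: "y \<in> rook_monoid n" and le: "rk_le (2 * n) ?g ?h"
    using xy(1) by (auto simp: rk_order_def)
  note g = rook_embedding(1)[OF x] and h = rook_embedding(1)[OF y]
  have "\<not> (\<forall>i\<le>2 * n. \<forall>u. rk ?g i u = rk ?h i u)"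
  proof
    assume "\<forall>i\<le>2 * n. \<forall>u. rk ?g i u = rk ?h i u"
    then have "?g = ?h"
      by (intro rk_le_antisym[OF g h]) (simp_all add: rk_le_def)
    then show False
      using rook_embedding_inject[OF x y] xy(2) by blast
  qed
  then obtain p j where min: "min_swap (2 * n) ?g ?h p j"
    using ex_min_swap[OF le rk_total_eq[OF g h]] by blast
  obtain z where z: "z \<in> rook_monoid n" "rook_embedding n z = swap ?g p j"
    using rook_embedding_surj[OF rook_functions_swap[OF g h le min]] by blast
  have "(z, y) \<in> rk_order n"
    using z y min_swap_le[OF min le rk_total_eq[OF g h]] by (simp add: rk_order_def)
  then show ?thesis
    using that z min by blast
qed

lemma inversions_bound: "inversions N g \<le> N * N"
proof -
  have "rk g k u \<le> N" if "k < N" for k u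
    using rk_index_bound[of 0 k g u] that by simp
  then have "inversions N g \<le> card {..<N} * N"
    unfolding inversions_def by (intro sum_bounded_above[where 'a = nat, simplified]) simp
  then show ?thesis
    by simp
qed

text \<open>Repeated greedy swaps climb from \<open>x\<close> to \<open>y\<close>. Each raises the
  bounded inversion number by one, which ends the ascent and makes the inversion number strictly
  increasing along the order.\<close>

lemma rk_order_imp_steps:
  assumes "(x, y) \<in> rk_order n"
  shows "(x, y) \<in> (bruhat_steps n)\<^sup>* \<and>
    (x \<noteq> y \<longrightarrow> inversions (2 * n) (rook_embedding n x) < inversions (2 * n) (rook_embedding n y))"
  using assms
proof (induction "2 * n * (2 * n) - inversions (2 * n) (rook_embedding n x)"
    arbitrary: x rule: less_induct)
  case less
  show ?case
  proof (cases "x = y")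
    case False
    obtain z p j where z: "z \<in> rook_monoid n" "(z, y) \<in> rk_order n"
      "rook_embedding n z = swap (rook_embedding n x) p j"
      and min: "min_swap (2 * n) (rook_embedding n x) (rook_embedding n y) p j"
      using rk_order_min_swap[OF less.prems False] .
    have cover: "cover_swap (2 * n) (rook_embedding n x) p j"
      using min by (simp add: min_swap_def)
    have x: "x \<in> rook_monoid n"
      using less.prems by (simp add: rk_order_def)
    have inv: "inversions (2 * n) (rook_embedding n z) = Suc (inversions (2 * n) (rook_embedding n x))"
      using inversions_swap[OF cover] z(3) by simp
    have "2 * n * (2 * n) - inversions (2 * n) (rook_embedding n z) <
        2 * n * (2 * n) - inversions (2 * n) (rook_embedding n x)"
      using inversions_bound[of "2 * n" "rook_embedding n z"] inv by linarith
    from less.hyps[OF this z(2)] show ?thesis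
      using swap_step(1)[OF x z(1,3) cover] inv
      by (cases "z = y") (auto intro: converse_rtrancl_into_rtrancl)
  qed simp
qed

text \<open>\<open>rk_order n\<close> is one of the partial orders in the intersection, and each of
  these contains all finite sequences of steps by reflexivity and transitivity.\<close>

lemma bruhat_le_eq: "bruhat_le n = rk_order n"
proof
  show "bruhat_le n \<subseteq> rk_order n"
    using partial_order_rk_order bruhat_steps_subset by (auto simp: bruhat_le_def)
  have "rk_order n \<subseteq> r" if r: "partial_order_on (rook_monoid n) r" "bruhat_steps n \<subseteq> r" for r
  proof clarify
    fix x y assume xy: "(x, y) \<in> rk_order n"
    then have "x \<in> rook_monoid n"
      by (simp add: rk_order_def)
    then have "(x, x) \<in> r"
      using partial_order_onD(1)[OF r(1)] by (simp add: refl_on_def)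
    have "(x, y) \<in> (bruhat_steps n)\<^sup>*"
      using rk_order_imp_steps[OF xy] ..
    then show "(x, y) \<in> r"
    proof induction
      case (step y z)
      then show ?case
        using partial_order_onD(2)[OF r(1)] r(2) by (meson subsetD transD)
    qed fact
  qed
  then show "rk_order n \<subseteq> bruhat_le n"
    unfolding bruhat_le_def by blast
qed

text \<open>The greedy swap towards \<open>y\<close> lies strictly above \<open>x\<close> and below
  \<open>y\<close>, so for a covering it is \<open>y\<close>. Conversely, a covering swap raises the
  inversion number by only one, which leaves no room for an intermediate element.\<close>

lemma covers_rk_order_iff:
  "(x, y) \<in> covers (rook_monoid n) (rk_order n) \<longleftrightarrow> x \<in> rook_monoid n \<and> y \<in> rook_monoid n \<and>
    (\<exists>p j. cover_swap (2 * n) (rook_embedding n x) p j \<and>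
      rook_embedding n y = swap (rook_embedding n x) p j)"
  (is "?L \<longleftrightarrow> ?R")
proof
  assume L: ?L
  then have xy: "(x, y) \<in> rk_order n" "x \<noteq> y" "x \<in> rook_monoid n" "y \<in> rook_monoid n"
    by (auto simp: covers_def)
  obtain z p j where z: "z \<in> rook_monoid n" "(z, y) \<in> rk_order n"
    "rook_embedding n z = swap (rook_embedding n x) p j"
    and min: "min_swap (2 * n) (rook_embedding n x) (rook_embedding n y) p j"
    using rk_order_min_swap[OF xy(1,2)] .
  have cover: "cover_swap (2 * n) (rook_embedding n x) p j"
    using min by (simp add: min_swap_def)
  have "(x, z) \<in> rk_order n"
    using swap_step(1)[OF xy(3) z(1,3) cover] bruhat_steps_subset by blast
  moreover have "x \<noteq> z"
    using inversions_swap[OF cover] z(3) by auto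
  ultimately have "z = y"
    using L z by (auto simp: covers_def)
  then show ?R
    using xy z cover by blast
next
  assume ?R
  then obtain p j where x: "x \<in> rook_monoid n" and y: "y \<in> rook_monoid n"
    and cover: "cover_swap (2 * n) (rook_embedding n x) p j"
    and eq: "rook_embedding n y = swap (rook_embedding n x) p j"
    by blast
  let ?inv = "\<lambda>x. inversions (2 * n) (rook_embedding n x)"
  have inv: "?inv y = Suc (?inv x)"
    using inversions_swap[OF cover] eq by simp
  have "(x, y) \<in> rk_order n"
    using swap_step(1)[OF x y eq cover] bruhat_steps_subset by blast
  moreover have "z = x \<or> z = y" if "(x, z) \<in> rk_order n" "(z, y) \<in> rk_order n" for z
    using rk_order_imp_steps[OF that(1)] rk_order_imp_steps[OF that(2)] inv by auto
  ultimately show ?L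
    using x y inv by (auto simp: covers_def)
qed

lemma rank_function_inversions:
  "rank_function (rook_monoid n) (rk_order n) (\<lambda>x. inversions (2 * n) (rook_embedding n x))"
proof -
  have "inversions (2 * n) (rook_embedding n y) = Suc (inversions (2 * n) (rook_embedding n x))"
    if "(x, y) \<in> covers (rook_monoid n) (rk_order n)" for x y
    using that inversions_swap unfolding covers_rk_order_iff by auto
  then show ?thesis
    using rk_order_imp_steps unfolding rank_function_def by blast
qed

section \<open>Labels along chains\<close>

lemma covers_label:
  assumes "(x, y) \<in> covers (rook_monoid n) (rk_order n)"
  obtains p j where "x \<in> rook_monoid n" "y \<in> rook_monoid n"
    "cover_swap (2 * n) (rook_embedding n x) p j"
    "rook_embedding n y = swap (rook_embedding n x) p j"
    "rook_label (x, y) = (rook_embedding n x p, rook_embedding n x j)"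
proof -
  obtain p j where pj: "x \<in> rook_monoid n" "y \<in> rook_monoid n"
    "cover_swap (2 * n) (rook_embedding n x) p j"
    "rook_embedding n y = swap (rook_embedding n x) p j"
    using assms unfolding covers_rk_order_iff by blast
  show ?thesis
    by (rule that[OF pj swap_step(2)[OF pj(1,2,4,3)]])
qed

text \<open>A swap changes only levels above its smaller value, so swaps of values above
  \<open>v\<close> leave level \<open>Suc v\<close> alone.\<close>

lemma chain_above_level:
  assumes "c \<in> maximal_chains (rook_monoid n) (rk_order n) x y"
    and "\<forall>l \<in> set (jordan_holder rook_label c). v < fst l"
  shows "rk (rook_embedding n y) i (Suc v) = rk (rook_embedding n x) i (Suc v)"
  using assms
proof (induction c arbitrary: x)
  case Nil
  then show ?case
    by (simp add: maximal_chains_def)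
next
  case (Cons a d)
  consider "x = y" | z where "(x, z) \<in> covers (rook_monoid n) (rk_order n)"
    "d \<in> maximal_chains (rook_monoid n) (rk_order n) z y" "a = x"
    using Cons.prems(1) by (subst (asm) maximal_chains_iff) blast
  then show ?case
  proof cases
    case 2
    obtain q l where q: "cover_swap (2 * n) (rook_embedding n x) q l"
      "rook_embedding n z = swap (rook_embedding n x) q l"
      "rook_label (x, z) = (rook_embedding n x q, rook_embedding n x l)"
      using covers_label[OF 2(1)] by blast
    have labels: "\<forall>l \<in> set (jordan_holder rook_label d). v < fst l" "v < rook_embedding n x q"
      using Cons.prems(2) q(3) 2(3) jordan_holder_Cons[OF 2(2), of rook_label] by auto
    have "rk (rook_embedding n z) i (Suc v) = rk (rook_embedding n x) i (Suc v)"
      using q(1,2) labels(2) by (simp add: rk_swap cover_swap_def)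
    then show ?thesis
      using Cons.IH[OF 2(2) labels(1)] by simp
  qed simp
qed

text \<open>As long as the labels have first component \<open>v\<close>, the value \<open>w > v\<close> stays at position \<open>j\<close>:
  a swap moving a copy of \<open>v\<close> beyond it would not be a covering.\<close>

lemma sorted_chain_level:
  assumes "c \<in> maximal_chains (rook_monoid n) (rk_order n) x y"
    and "sorted (jordan_holder rook_label c)"
    and "\<forall>l \<in> set (jordan_holder rook_label c). (v, w) < l"
    and "rook_embedding n x j = w" "v < w"
  shows "rk (rook_embedding n y) j (Suc v) = rk (rook_embedding n x) j (Suc v)"
  using assms(1-4)
proof (induction c arbitrary: x)
  case Nil
  then show ?case
    by (simp add: maximal_chains_def)
next
  case (Cons a d)
  consider "x = y" | z where "(x, z) \<in> covers (rook_monoid n) (rk_order n)"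
    "d \<in> maximal_chains (rook_monoid n) (rk_order n) z y" "a = x"
    using Cons.prems(1) by (subst (asm) maximal_chains_iff) blast
  then show ?case
  proof cases
    case 2
    let ?g = "rook_embedding n x"
    obtain q l where cover: "cover_swap (2 * n) ?g q l"
      and z: "rook_embedding n z = swap ?g q l"
      and label: "rook_label (x, z) = (?g q, ?g l)"
      using covers_label[OF 2(1)] by blast
    note J = jordan_holder_Cons[OF 2(2), of rook_label x]
    have sorted: "sorted (jordan_holder rook_label d)"
      "\<forall>l \<in> set (jordan_holder rook_label d). rook_label (x, z) \<le> l"
      using Cons.prems(2) J 2(3) by auto
    have gt: "(v, w) < (?g q, ?g l)" "\<forall>l \<in> set (jordan_holder rook_label d). (v, w) < l"
      using Cons.prems(3) J 2(3) label by auto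
    have ql: "q < l" "?g q < ?g l"
      using cover by (auto simp: cover_swap_def)
    show ?thesis
    proof (cases "v < ?g q")
      case True
      \<comment> \<open>Once the first component exceeds \<open>v\<close>, sortedness keeps it there
        and level \<open>Suc v\<close> is frozen.\<close>
      have "\<forall>l \<in> set (jordan_holder rook_label (a # d)). v < fst l"
        using sorted(2) True J 2(3) label by (auto simp: less_eq_prod_def)
      then show ?thesis
        by (rule chain_above_level[OF Cons.prems(1)])
    next
      case False
      then have q: "?g q = v" "w < ?g l"
        using gt(1) by auto
      then have "j \<noteq> q" "j \<noteq> l"
        using Cons.prems(4) \<open>v < w\<close> by auto
      then have "\<not> (q < j \<and> j \<le> l)"
        using cover q Cons.prems(4) \<open>v < w\<close> unfolding cover_swap_def
        by (metis le_neq_implies_less less_asym)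
      then have "rk (rook_embedding n z) j (Suc v) = rk ?g j (Suc v)"
        using ql by (auto simp: z rk_swap)
      moreover have "rook_embedding n z j = w"
        using z \<open>j \<noteq> q\<close> \<open>j \<noteq> l\<close> Cons.prems(4) by simp
      ultimately show ?thesis
        using Cons.IH[OF 2(2) sorted(1) gt(2)] by simp
    qed
  qed simp
qed

text \<open>The greedy swap provides the \<open>z\<close> of the criterion. An increasing chain with
  another first step has only labels above that of \<open>(x, z)\<close>, so the deficit at
  \<open>j\<close> that defines the greedy swap would never be filled.\<close>

lemma EL_labeling_rook_label:
  "EL_labeling (rook_monoid n) (rk_order n) ({0..n} \<times> {0..n}) rook_label"
proof (rule EL_labelingI[OF partial_order_rk_order rank_function_inversions])
  let ?P = "rook_monoid n" and ?r = "rk_order n" and ?E = "rook_embedding n"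
  show "rook_label \<in> covers ?P ?r \<rightarrow> {0..n} \<times> {0..n}"
  proof
    fix e assume "e \<in> covers ?P ?r"
    then show "rook_label e \<in> {0..n} \<times> {0..n}"
      using rook_functions_le[OF rook_embedding(1)]
      by (cases e) (auto elim!: covers_label)
  qed
  fix x y assume x: "x \<in> ?P" and y: "y \<in> ?P" and xy: "(x, y) \<in> ?r" "x \<noteq> y"
  obtain z p j where z: "z \<in> ?P" "(z, y) \<in> ?r" "?E z = swap (?E x) p j"
    and min: "min_swap (2 * n) (?E x) (?E y) p j"
    using rk_order_min_swap[OF xy] .
  have cover: "cover_swap (2 * n) (?E x) p j"
    using min by (simp add: min_swap_def)
  then have pj: "?E x p < ?E x j" "j < 2 * n"
    by (auto simp: cover_swap_def)
  have xz: "(x, z) \<in> covers ?P ?r"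
    using x z cover unfolding covers_rk_order_iff by blast
  have label: "rook_label (x, z) = (?E x p, ?E x j)"
    using swap_step(2)[OF x z(1,3) cover] .
  have least: "rook_label (x, z) < rook_label (x, z')"
    if z': "(x, z') \<in> covers ?P ?r" "(z', y) \<in> ?r" "z' \<noteq> z" for z'
  proof -
    obtain q l where q: "z' \<in> ?P" "cover_swap (2 * n) (?E x) q l" "?E z' = swap (?E x) q l"
      "rook_label (x, z') = (?E x q, ?E x l)"
      using covers_label[OF z'(1)] by metis
    have "rk_le (2 * n) (swap (?E x) q l) (?E y)"
      using z'(2) q(3) by (simp add: rk_order_def)
    then have le: "(?E x p, ?E x j) \<le> (?E x q, ?E x l)"
      by (rule min_swap_least[OF min q(2)])
    have "(?E x p, ?E x j) \<noteq> (?E x q, ?E x l)"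
    proof
      assume eq: "(?E x p, ?E x j) = (?E x q, ?E x l)"
      \<comment> \<open>The value \<open>?E x j\<close> is positive because it exceeds
        \<open>?E x p\<close>, so it occurs only once below \<open>2 * n\<close>.\<close>
      then have "j = l"
        using rook_functions_distinct[OF rook_embedding(1)[OF x]] pj q(2) by (auto simp: cover_swap_def)
      then have "p = q"
        using cover_swap_inject[OF cover q(2)] eq by simp
      then show False
        using rook_embedding_inject[OF q(1) z(1)] q(3) z(3) z'(3) \<open>j = l\<close> by simp
    qed
    with le show ?thesis
      unfolding label q(4) by (rule le_neq_trans)
  qed
  moreover have "rook_label (x, z) \<le> rook_label (z, z')"
    if z': "(z, z') \<in> covers ?P ?r" "(z', y) \<in> ?r" for z'
  proof -
    obtain q l where q: "cover_swap (2 * n) (?E z) q l" "?E z' = swap (?E z) q l"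
      "rook_label (z, z') = (?E z q, ?E z l)"
      using covers_label[OF z'(1)] by metis
    have "rk_le (2 * n) (swap (?E z) q l) (?E y)"
      using z'(2) q(2) by (simp add: rk_order_def)
    then show ?thesis
      using min_swap_next_label[OF min, of q l] q(1,3) z(3) label by simp
  qed
  moreover have "hd (tl c) = z"
    if c: "c \<in> maximal_chains ?P ?r x y" "sorted (jordan_holder rook_label c)" for c
  proof (rule ccontr)
    assume "hd (tl c) \<noteq> z"
    obtain z' d where d: "c = x # d" "(x, z') \<in> covers ?P ?r" "d \<in> maximal_chains ?P ?r z' y"
      using c(1) xy(2) by (subst (asm) maximal_chains_iff) blast
    then have "z' \<noteq> z"
      using \<open>hd (tl c) \<noteq> z\<close> by (auto simp: maximal_chains_def)
    have "z' \<in> ?P"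
      using d(2) by (simp add: covers_def)
    then have "(z', y) \<in> ?r"
      using maximal_chains_rank[OF partial_order_rk_order rank_function_inversions d(3)] by blast
    then have "rook_label (x, z) < rook_label (x, z')"
      using least d(2) \<open>z' \<noteq> z\<close> by blast
    then have "\<forall>l \<in> set (jordan_holder rook_label c). (?E x p, ?E x j) < l"
      using c(2) d(1) jordan_holder_Cons[OF d(3), of rook_label x] unfolding label
      by (auto simp del: less_prod_simp intro: less_le_trans)
    then have "rk (?E y) j (Suc (?E x p)) = rk (?E x) j (Suc (?E x p))"
      by (rule sorted_chain_level[OF c _ refl pj(1)])
    then show False
      using min by (simp add: min_swap_def)
  qed
  ultimately show "\<exists>z. (x, z) \<in> covers ?P ?r \<and> (z, y) \<in> ?r \<and>
      (\<forall>z'. (x, z') \<in> covers ?P ?r \<and> (z', y) \<in> ?r \<and> z' \<noteq> z \<longrightarrow> rook_label (x, z) < rook_label (x, z')) \<and>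
      (\<forall>z'. (z, z') \<in> covers ?P ?r \<and> (z', y) \<in> ?r \<longrightarrow> rook_label (x, z) \<le> rook_label (z, z')) \<and>
      (\<forall>c \<in> maximal_chains ?P ?r x y. sorted (jordan_holder rook_label c) \<longrightarrow> hd (tl c) = z)"
    using xz z(2) by blast
qed

theorem theorem3p2:
  fixes n :: nat
  shows "EL_labeling (rook_monoid n) (bruhat_le n) ({0..n} \<times> {0..n}) rook_label \<and>
    EL_shellable TYPE(nat \<times> nat) (rook_monoid n) (bruhat_le n)"
  using EL_labeling_rook_label[of n] unfolding bruhat_le_eq EL_shellable_def by blast

end
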